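(* Let $\alpha\in(0,1]$. The price of anarchy of financial network games under priority-proportional strategies (non-negative external assets, debt contracts only) with default costs $(\alpha,1)$, when firms aim to maximize their equity, is at most $1/\alpha$. This holds even if the clearing payments that are realized are not maximal: for any rule selecting, for each strategy profile, some consistent clearing payments as the realized ones, every clearing payments $\mathbf{P}$ realized at a Nash equilibrium satisfy $OPT\le \frac{1}{\alpha}\,SW(\mathbf{P})$.
   Context: Financial network: firms $v_1,\dots,v_n$; each $v_i$ has external assets $e_i\ge 0$; $v_i$ owes $v_j$ the liability $l_{ij}\ge 0$, with $l_{ii}=0$ (both $l_{ij}>0$ and $l_{ji}>0$ are allowed); $L_i=\sum_j l_{ij}$. Default costs $(\alpha,\beta)$: a firm in default can use only an $\alpha$ fraction of its external assets and a $\beta$ fraction of its incoming payments; here $\beta=1$. Priority-proportional strategy: a strategy $s_i$ of $v_i$ is a complete ordering, allowing ties, of its creditors, i.e. an ordered partition of $\{v_j: l_{ij}>0\}$ into priority classes $1,2,\dots$. Write $L_i^{(m)}$ for the total liability of $v_i$ to its $m$-th class, $k_{ij}$ for the index of the class of $v_i$ containing $v_j$, and $\pi'_{ij}=l_{ij}/L_i^{(k_{ij})}$. Clearing payments consistent with a strategy profile $\mathbf{s}=(s_1,\dots,s_n)$: a matrix $\mathbf{P}=(p_{ij})$ with $p_{ii}=0$, $0\le p_{ij}\le l_{ij}$ and, writing $p_i=\sum_j p_{ij}$, for every $i$: $p_i=L_i$ if $L_i\le e_i+\sum_j p_{ji}$ (solvent), and $p_i=\alpha e_i+\sum_j p_{ji}$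 otherwise (in default); moreover for every creditor $v_j$ of $v_i$, $$p_{ij}=\min\Big\{\max\Big\{\Big(p_i-\sum_{m=1}^{k_{ij}-1}L_i^{(m)}\Big)\pi'_{ij},\,0\Big\},\,l_{ij}\Big\},$$ and $p_{ij}=0$ if $l_{ij}=0$. Clearing payments are proper if every firm with a positive outgoing payment is reachable, by a (possibly trivial) directed path of edges $(v_i,v_j)$ with $p_{ij}>0$, from some firm with positive external assets. Only proper clearing payments are considered. For every profile there are maximal ones, which are entrywise at least as large as all other proper clearing payments consistent with the profile; by default these are the realized ones. Equity: $E_i(\mathbf{P})=\max\{0,\ e_i+\sum_j p_{ji}-L_i\}$. The utility of $v_i$ under a profile is its equity under the realized clearing payments. A profile is a (pure) Nash equilibrium if no firm can strictly increase its utility by unilaterally changing its priority-proportional strategy. Social welfare: $SW(\mathbf{P})=\sum_i E_i(\mathbf{P})$; $OPT$ is the maximum of the social welfare of the realized clearing payments over all strategy profiles. The price of anarchy of an instance is the maximum of $OPT/SW(\mathbf{P})$ over clearing payments $\mathbf{P}$ realized at Nash equilibria (with $0/0=1$). *)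

theory Defs
  imports "HOL-Library.Disjoint_Sets" "HOL-Library.Extended_Real"
begin

text \<open>The firms are the elements of a finite type; \<open>liab N i j\<close> is what firm \<open>i\<close> owes to
  firm \<open>j\<close>, and \<open>alpha\<close>, \<open>beta\<close> are the default costs.\<close>

record 'v network =
  assets :: "'v \<Rightarrow> real"
  liab :: "'v \<Rightarrow> 'v \<Rightarrow> real"
  alpha :: real
  beta :: real

definition valid_network :: "'v network \<Rightarrow> bool" where
  "valid_network N \<longleftrightarrow>
     (\<forall>i. 0 \<le> assets N i) \<and> (\<forall>i j. 0 \<le> liab N i j) \<and> (\<forall>i. liab N i i = 0)"

definition total_liab :: "('v::finite) network \<Rightarrow> 'v \<Rightarrow> real" where
  "total_liab N i = (\<Sum>j\<in>UNIV. liab N i j)"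

definition creditors :: "'v network \<Rightarrow> 'v \<Rightarrow> 'v set" where
  "creditors N i = {j. liab N i j > 0}"

text \<open>A priority-proportional strategy is the list of its priority classes, the class of
  highest priority first.  List positions start at 0, so the \<open>m\<close>-th class of the informal
  notation is at position \<open>m - 1\<close>.\<close>

type_synonym 'v strategy = "'v set list"
type_synonym 'v profile = "'v \<Rightarrow> 'v strategy"
type_synonym 'v payments = "'v \<Rightarrow> 'v \<Rightarrow> real"

definition is_strategy :: "'v network \<Rightarrow> 'v \<Rightarrow> 'v strategy \<Rightarrow> bool" where
  "is_strategy N i c \<longleftrightarrow> distinct c \<and> partition_on (creditors N i) (set c)"

definition profiles :: "'v network \<Rightarrow> 'v profile set" where
  "profiles N = {s. \<forall>i. is_strategy N i (s i)}"

definition class_liab :: "'v network \<Rightarrow> 'v \<Rightarrow> 'v strategy \<Rightarrow> nat \<Rightarrow> real" where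
  "class_liab N i c m = (\<Sum>j\<in>c ! m. liab N i j)"

definition class_index :: "'v strategy \<Rightarrow> 'v \<Rightarrow> nat" where
  "class_index c j = (THE k. k < length c \<and> j \<in> c ! k)"

definition outgoing :: "('v::finite) payments \<Rightarrow> 'v \<Rightarrow> real" where
  "outgoing P i = (\<Sum>j\<in>UNIV. P i j)"

definition incoming :: "('v::finite) payments \<Rightarrow> 'v \<Rightarrow> real" where
  "incoming P i = (\<Sum>j\<in>UNIV. P j i)"

definition solvent :: "('v::finite) network \<Rightarrow> 'v payments \<Rightarrow> 'v \<Rightarrow> bool" where
  "solvent N P i \<longleftrightarrow> total_liab N i \<le> assets N i + incoming P i"

definition clearing :: "('v::finite) network \<Rightarrow> 'v profile \<Rightarrow> 'v payments \<Rightarrow> bool" where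
  "clearing N s P \<longleftrightarrow>
     (\<forall>i. P i i = 0) \<and>
     (\<forall>i j. 0 \<le> P i j \<and> P i j \<le> liab N i j) \<and>
     (\<forall>i. outgoing P i =
            (if solvent N P i then total_liab N i
             else alpha N * assets N i + beta N * incoming P i)) \<and>
     (\<forall>i j. P i j =
        (if j \<in> creditors N i
         then let k = class_index (s i) j in
              min (max ((outgoing P i - (\<Sum>m<k. class_liab N i (s i) m))
                        * (liab N i j / class_liab N i (s i) k)) 0)
                  (liab N i j)
         else 0))"

definition proper :: "('v::finite) network \<Rightarrow> 'v payments \<Rightarrow> bool" where
  "proper N P \<longleftrightarrow>
     (\<forall>i. outgoing P i > 0 \<longrightarrow>
        (\<exists>v. assets N v > 0 \<and> (v, i) \<in> {(a, b). P a b > 0}\<^sup>*))"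

definition proper_clearing :: "('v::finite) network \<Rightarrow> 'v profile \<Rightarrow> 'v payments \<Rightarrow> bool" where
  "proper_clearing N s P \<longleftrightarrow> clearing N s P \<and> proper N P"

text \<open>The order on payments is the pointwise one.\<close>

definition max_clearing :: "('v::finite) network \<Rightarrow> 'v profile \<Rightarrow> 'v payments" where
  "max_clearing N s = (GREATEST P. proper_clearing N s P)"

definition equity :: "('v::finite) network \<Rightarrow> 'v payments \<Rightarrow> 'v \<Rightarrow> real" where
  "equity N P i = max 0 (assets N i + incoming P i - total_liab N i)"

definition social_welfare :: "('v::finite) network \<Rightarrow> 'v payments \<Rightarrow> real" where
  "social_welfare N P = (\<Sum>i\<in>UNIV. equity N P i)"

text \<open>A rule \<open>R\<close> maps every profile to the clearing payments that are realized under it;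
  its values outside \<^term>\<open>profiles N\<close> play no role.  The default rule is
  \<^term>\<open>max_clearing N\<close>.\<close>

definition selection_rule ::
    "('v::finite) network \<Rightarrow> ('v profile \<Rightarrow> 'v payments) \<Rightarrow> bool" where
  "selection_rule N R \<longleftrightarrow> (\<forall>s\<in>profiles N. proper_clearing N s (R s))"

definition nash :: "('v::finite) network \<Rightarrow> ('v profile \<Rightarrow> 'v payments) \<Rightarrow> 'v profile \<Rightarrow> bool" where
  "nash N R s \<longleftrightarrow>
     s \<in> profiles N \<and>
     (\<forall>i c. is_strategy N i c \<longrightarrow> equity N (R (s(i := c))) i \<le> equity N (R s) i)"

text \<open>A network has finitely many profiles, and at least one.\<close>

definition opt_welfare :: "('v::finite) network \<Rightarrow> ('v profile \<Rightarrow> 'v payments) \<Rightarrow> real" where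
  "opt_welfare N R = Max ((\<lambda>s. social_welfare N (R s)) ` profiles N)"

definition welfare_ratio :: "real \<Rightarrow> real \<Rightarrow> ereal" where
  "welfare_ratio a b =
     (if b = 0 then (if a = 0 then 1 else \<infinity>) else ereal (a / b))"

text \<open>The supremum is over finitely many values, hence a maximum unless there is no
  equilibrium, in which case it is \<open>-\<infinity>\<close>.\<close>

definition price_of_anarchy ::
    "('v::finite) network \<Rightarrow> ('v profile \<Rightarrow> 'v payments) \<Rightarrow> ereal" where
  "price_of_anarchy N R =
     (SUP s\<in>{s. nash N R s}. welfare_ratio (opt_welfare N R) (social_welfare N (R s)))"

end

theory Submission
  imports Defs "HOL-Library.Function_Algebras"
begin

text \<open>With \<open>\<beta> = 1\<close> the only value lost in the network is the fraction \<open>1 - \<alpha>\<close> of the external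
  assets of the defaulting firms.  Hence every clearing payments have a social welfare between
  \<open>\<alpha>\<close> times the total external assets and the total external assets, at an equilibrium or not.

  What remains is that maximal proper clearing payments exist.  Clearing payments are the fixed
  points of a monotone map on payments, and this map preserves properness.  The pointwise supremum
  of all proper payments that are dominated by their image is again of this kind, so it is a fixed
  point, as in the theorem of Knaster and Tarski.\<close>

subsection \<open>Dividing a payment among the priority classes\<close>

text \<open>The payment formula of \<open>clearing\<close> as a function of the total
  \<open>x\<close> that firm \<open>i\<close> pays out, so that its sum and monotonicity in
  \<open>x\<close> can be studied for a single firm.\<close>

definition allotment ::
    "'v network \<Rightarrow> 'v \<Rightarrow> 'v strategy \<Rightarrow> real \<Rightarrow> 'v \<Rightarrow> real" where
  "allotment N i c x j =
     (if j \<in> creditors N i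
      then let k = class_index c j in
           min (max ((x - (\<Sum>m<k. class_liab N i c m)) * (liab N i j / class_liab N i c k)) 0)
               (liab N i j)
      else 0)"

lemma allotment_le: "valid_network N \<Longrightarrow> allotment N i c x j \<le> liab N i j"
  by (simp add: allotment_def valid_network_def Let_def)

lemma allotment_nonneg: "valid_network N \<Longrightarrow> 0 \<le> allotment N i c x j"
  by (simp add: allotment_def valid_network_def Let_def)

lemma class_liab_nonneg: "valid_network N \<Longrightarrow> 0 \<le> class_liab N i c m"
  by (simp add: class_liab_def valid_network_def sum_nonneg)

lemma allotment_mono:
  assumes "valid_network N" "x \<le> y"
  shows "allotment N i c x j \<le> allotment N i c y j"
proof -
  have "0 \<le> liab N i j / class_liab N i c k" for k
    using assms(1) class_liab_nonneg[OF assms(1)] by (simp add: valid_network_def)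
  then have "(x - t) * (liab N i j / class_liab N i c k)
      \<le> (y - t) * (liab N i j / class_liab N i c k)" for t k
    using assms(2) by (intro mult_right_mono) auto
  then show ?thesis
    unfolding allotment_def Let_def
    by (cases "j \<in> creditors N i") (simp_all only: if_True if_False min.mono max.mono order_refl)
qed

text \<open>Disjointness makes two classes containing \<open>j\<close> equal as sets, and
  distinctness of the list then makes their positions equal, so \<open>THE\<close> is well
  defined.\<close>

lemma class_index_eq:
  assumes "is_strategy N i c" "k < length c" "j \<in> c ! k"
  shows "class_index c j = k"
  unfolding class_index_def
proof (rule the_equality)
  fix m assume m: "m < length c \<and> j \<in> c ! m"
  have "c ! m = c ! k"
    using assms m unfolding is_strategy_def partition_on_def disjoint_def
    by (metis IntI empty_iff nth_mem)
  then show "m = k"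
    using assms m unfolding is_strategy_def by (simp add: nth_eq_iff_index_eq)
qed (use assms in simp)

lemma sum_creditors:
  fixes N :: "('v::finite) network"
  assumes "is_strategy N i c"
  shows "(\<Sum>j\<in>creditors N i. f j) = (\<Sum>k<length c. \<Sum>j\<in>c ! k. f j)"
proof -
  have "(\<Sum>j\<in>creditors N i. f j) = (\<Sum>j\<in>\<Union>(set c). f j)"
    using assms by (simp add: is_strategy_def partition_on_def)
  also have "\<dots> = (\<Sum>C\<in>set c. \<Sum>j\<in>C. f j)"
    using assms unfolding is_strategy_def partition_on_def disjoint_def
    by (subst sum.Union_disjoint) auto
  also have "\<dots> = (\<Sum>k<length c. \<Sum>j\<in>c ! k. f j)"
    using assms unfolding is_strategy_def
    by (intro sum.reindex_bij_betw[symmetric] bij_betw_nth) auto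
  finally show ?thesis .
qed

lemma class_subset_creditors:
  "is_strategy N i c \<Longrightarrow> k < length c \<Longrightarrow> c ! k \<subseteq> creditors N i"
  unfolding is_strategy_def partition_on_def by (metis Union_upper nth_mem)

lemma class_liab_pos:
  fixes N :: "('v::finite) network"
  assumes "is_strategy N i c" "k < length c"
  shows "0 < class_liab N i c k"
proof -
  have "c ! k \<noteq> {}"
    using assms unfolding is_strategy_def partition_on_def by (metis nth_mem)
  then show ?thesis
    using class_subset_creditors[OF assms]
    unfolding class_liab_def creditors_def by (intro sum_pos) auto
qed

lemma sum_class_liab:
  fixes N :: "('v::finite) network"
  assumes "valid_network N" "is_strategy N i c"
  shows "(\<Sum>k<length c. class_liab N i c k) = total_liab N i"
proof -
  have "total_liab N i = (\<Sum>j\<in>creditors N i. liab N i j)"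
    unfolding total_liab_def
    using assms(1) by (intro sum.mono_neutral_right)
      (auto simp: creditors_def valid_network_def not_less intro: antisym)
  then show ?thesis
    using sum_creditors[OF assms(2), of "liab N i"] by (simp add: class_liab_def)
qed

text \<open>Class \<open>k\<close> absorbs the part of \<open>x\<close> lying between the cumulative
  liabilities before and after it. The difference form is chosen to telescope over the
  classes.\<close>

lemma sum_allotment_class:
  fixes N :: "('v::finite) network"
  assumes "valid_network N" "is_strategy N i c" "k < length c"
  shows "(\<Sum>j\<in>c ! k. allotment N i c x j) =
    min x (\<Sum>m<Suc k. class_liab N i c m) - min x (\<Sum>m<k. class_liab N i c m)"
proof -
  define C where "C = class_liab N i c k"
  define A where "A = (\<Sum>m<k. class_liab N i c m)"
  have C: "0 < C"
    using class_liab_pos[OF assms(2,3)] by (simp add: C_def)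
  have "allotment N i c x j = liab N i j * (min (max (x - A) 0) C / C)" if "j \<in> c ! k" for j
  proof -
    have l: "0 < liab N i j" "j \<in> creditors N i"
      using class_subset_creditors[OF assms(2,3)] that by (auto simp: creditors_def)
    have "allotment N i c x j = min (max ((x - A) * (liab N i j / C)) 0) (liab N i j)"
      using l class_index_eq[OF assms(2,3) that] by (simp add: allotment_def A_def C_def)
    also have "\<dots> = liab N i j * (min (max (x - A) 0) C / C)"
    proof -
      \<comment> \<open>As the cap \<open>liab N i j\<close> equals \<open>C * r\<close>, the
        nonnegative factor \<open>r\<close> can be pulled out of both \<open>max\<close> and
        \<open>min\<close>.\<close>
      define r where "r = liab N i j / C"
      have "0 \<le> r" "liab N i j = C * r"
        using C l(1) by (simp_all add: r_def)
      then show ?thesis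
        using C by (simp add: min_mult_distrib_right max_mult_distrib_right mult.commute[of r])
    qed
    finally show ?thesis .
  qed
  then have "(\<Sum>j\<in>c ! k. allotment N i c x j) = C * (min (max (x - A) 0) C / C)"
    by (simp only: sum_distrib_right[symmetric] C_def class_liab_def cong: sum.cong)
  also have "\<dots> = min x (A + C) - min x A"
    using C by (auto simp: min_def max_def)
  finally show ?thesis
    by (simp add: A_def C_def)
qed

text \<open>The class sums telescope to \<open>min x (total_liab N i) - min x 0\<close>, which the
  two bounds on \<open>x\<close> reduce to \<open>x\<close>.\<close>

lemma sum_allotment:
  fixes N :: "('v::finite) network"
  assumes "valid_network N" "is_strategy N i c" "0 \<le> x" "x \<le> total_liab N i"
  shows "(\<Sum>j\<in>UNIV. allotment N i c x j) = x"
proof -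
  define A where "A = (\<lambda>k. \<Sum>m<k. class_liab N i c m)"
  have "(\<Sum>j\<in>UNIV. allotment N i c x j) = (\<Sum>j\<in>creditors N i. allotment N i c x j)"
    by (intro sum.mono_neutral_right) (auto simp: allotment_def)
  also have "\<dots> = (\<Sum>k<length c. min x (A (Suc k)) - min x (A k))"
    using sum_allotment_class[OF assms(1,2)]
    by (simp add: sum_creditors[OF assms(2)] A_def)
  also have "\<dots> = min x (A (length c)) - min x (A 0)"
    by (rule sum_lessThan_telescope)
  also have "\<dots> = x"
    using assms(3,4) sum_class_liab[OF assms(1,2)] by (simp add: A_def)
  finally show ?thesis .
qed

subsection \<open>Maximal proper clearing payments\<close>

definition payout :: "('v::finite) network \<Rightarrow> 'v payments \<Rightarrow> 'v \<Rightarrow> real" where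
  "payout N P i =
     (if solvent N P i then total_liab N i
      else alpha N * assets N i + beta N * incoming P i)"

text \<open>Dividing \<open>payout N P i\<close> rather than \<open>outgoing P i\<close> merges the
  two equations of \<open>clearing\<close> into one fixed-point equation.\<close>

definition clearing_map ::
    "('v::finite) network \<Rightarrow> 'v profile \<Rightarrow> 'v payments \<Rightarrow> 'v payments" where
  "clearing_map N s P i j = allotment N i (s i) (payout N P i) j"

lemma clearing_iff:
  "clearing N s P \<longleftrightarrow>
     (\<forall>i. P i i = 0) \<and> (\<forall>i j. 0 \<le> P i j \<and> P i j \<le> liab N i j) \<and>
     (\<forall>i. outgoing P i = payout N P i) \<and> (\<forall>i j. P i j = allotment N i (s i) (outgoing P i) j)"
  by (simp add: clearing_def payout_def allotment_def)

lemma total_liab_nonneg: "valid_network N \<Longrightarrow> 0 \<le> total_liab N i"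
  by (simp add: total_liab_def valid_network_def sum_nonneg)

lemma incoming_nonneg: "0 \<le> P \<Longrightarrow> 0 \<le> incoming P i"
  by (simp add: incoming_def le_fun_def sum_nonneg)

lemma incoming_mono: "P \<le> Q \<Longrightarrow> incoming P i \<le> incoming Q i"
  by (simp add: incoming_def le_fun_def sum_mono)

lemma outgoing_pos_iff:
  assumes "0 \<le> P"
  shows "0 < outgoing P i \<longleftrightarrow> (\<exists>j. 0 < P i j)"
proof -
  have *: "0 \<le> P i j" for j
    using assms by (simp add: le_fun_def)
  show ?thesis
    using sum_nonneg_0[of UNIV "P i"] sum_pos2[of UNIV _ "P i"] * sum_nonpos[of UNIV "P i"]
    unfolding outgoing_def by (metis UNIV_I finite_UNIV linorder_not_less)
qed

lemma incoming_pos_iff: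
  assumes "0 \<le> P"
  shows "0 < incoming P i \<longleftrightarrow> (\<exists>j. 0 < P j i)"
  using outgoing_pos_iff[of "\<lambda>i j. P j i" i] assms
  by (simp add: incoming_def outgoing_def le_fun_def)

context
  fixes N :: "('v::finite) network"
  assumes valid: "valid_network N"
    and alpha: "0 \<le> alpha N" "alpha N \<le> 1"
    and beta: "beta N = 1"
begin

lemma assets_nonneg: "0 \<le> assets N i"
  using valid by (simp add: valid_network_def)

lemma alpha_assets: "0 \<le> alpha N * assets N i" "alpha N * assets N i \<le> assets N i"
  using alpha assets_nonneg[of i] by (simp_all add: mult_left_le_one_le)

text \<open>In default, the payout is at most the assets plus incoming payments, which fall short of
  the liabilities.\<close>

lemma payout_le: "payout N P i \<le> total_liab N i"
  using alpha_assets[of i] by (auto simp: payout_def solvent_def beta)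

lemma payout_nonneg: "0 \<le> P \<Longrightarrow> 0 \<le> payout N P i"
  using alpha_assets(1)[of i] incoming_nonneg[of P i] total_liab_nonneg[OF valid, of i]
  by (auto simp: payout_def beta)

text \<open>Larger payments keep solvent firms solvent. A firm that becomes solvent jumps to its
  total liability, which bounds every payout.\<close>

lemma payout_mono:
  assumes "P \<le> Q"
  shows "payout N P i \<le> payout N Q i"
  using incoming_mono[OF assms, of i] alpha_assets[of i]
  by (auto simp: payout_def solvent_def beta)

lemma clearing_map_mono: "P \<le> Q \<Longrightarrow> clearing_map N s P \<le> clearing_map N s Q"
  by (simp add: le_fun_def clearing_map_def allotment_mono valid payout_mono)

lemma clearing_fixed_point: "clearing N s P \<Longrightarrow> clearing_map N s P = P"
  by (intro ext) (metis clearing_iff clearing_map_def)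

text \<open>Summing the fixed-point equation over \<open>j\<close> recovers
  \<open>outgoing P i = payout N P i\<close> by \<open>sum_allotment\<close>; the priority equation
  then follows by substitution.\<close>

lemma fixed_point_clearing:
  assumes "s \<in> profiles N" "0 \<le> P" "clearing_map N s P = P"
  shows "clearing N s P"
proof -
  have P: "P i j = allotment N i (s i) (payout N P i) j" for i j
    using assms(3) by (metis clearing_map_def)
  have bnd: "0 \<le> P i j" "P i j \<le> liab N i j" for i j
    by (subst P, simp add: allotment_nonneg allotment_le valid)+
  have "outgoing P i = (\<Sum>j\<in>UNIV. allotment N i (s i) (payout N P i) j)" for i
    unfolding outgoing_def using P by (intro sum.cong) auto
  then have out: "outgoing P i = payout N P i" for i
    using assms(1,2) payout_le payout_nonneg
    by (simp add: sum_allotment valid profiles_def)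
  have "P i i = 0" for i
    using bnd[of i i] valid by (simp add: valid_network_def antisym)
  then show ?thesis
    unfolding clearing_iff using bnd out P by auto
qed

lemma clearing_map_nonneg: "0 \<le> clearing_map N s P"
  by (simp add: le_fun_def clearing_map_def allotment_nonneg valid)

lemma proper_clearing_map:
  assumes "s \<in> profiles N" "0 \<le> P" "P \<le> clearing_map N s P" "proper N P"
  shows "proper N (clearing_map N s P)"
  unfolding proper_def
proof (intro allI impI)
  fix i assume "0 < outgoing (clearing_map N s P) i"
  moreover have "outgoing (clearing_map N s P) i = payout N P i"
    using assms(1,2) payout_le payout_nonneg
    by (simp add: outgoing_def clearing_map_def sum_allotment valid profiles_def)
  ultimately have pos: "0 < payout N P i"
    by simp
  \<comment> \<open>Paths of \<open>P\<close> survive in its image because \<open>P\<close> is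
    dominated by it.\<close>
  have mono: "{(a, b). 0 < P a b}\<^sup>* \<subseteq> {(a, b). 0 < clearing_map N s P a b}\<^sup>*"
    using assms(3) by (intro rtrancl_mono) (auto simp: le_fun_def intro: less_le_trans)
  show "\<exists>v. 0 < assets N v \<and> (v, i) \<in> {(a, b). 0 < clearing_map N s P a b}\<^sup>*"
  proof (cases "0 < assets N i")
    case False
    then have "assets N i = 0"
      using assets_nonneg[of i] by simp
    \<comment> \<open>Without assets, a positive payout is covered by incoming payments. Their payer
      is reachable under \<open>P\<close>, and one more edge leads to \<open>i\<close>.\<close>
    then have "0 < incoming P i"
      using pos incoming_nonneg[OF assms(2), of i]
      by (auto simp: payout_def solvent_def beta split: if_splits)
    then obtain j where j: "0 < P j i"
      using incoming_pos_iff[OF assms(2)] by auto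
    then have "0 < outgoing P j"
      using outgoing_pos_iff[OF assms(2)] by auto
    then obtain v where "0 < assets N v" "(v, j) \<in> {(a, b). 0 < P a b}\<^sup>*"
      using assms(4) by (auto simp: proper_def)
    then have "0 < assets N v \<and> (v, i) \<in> {(a, b). 0 < P a b}\<^sup>*"
      using j by (auto intro: rtrancl_into_rtrancl)
    then show ?thesis
      using mono by blast
  qed auto
qed

lemma greatest_proper_clearing:
  assumes s: "s \<in> profiles N"
  obtains P where "proper_clearing N s P" "\<And>Q. proper_clearing N s Q \<Longrightarrow> Q \<le> P"
proof -
  define A where "A = {X. 0 \<le> X \<and> X \<le> clearing_map N s X \<and> proper N X}"
  define U where "U = (\<lambda>i j. SUP X\<in>A. X i j)"
  have bdd: "bdd_above ((\<lambda>X. X i j) ` A)" for i j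
  proof (rule bdd_aboveI2)
    fix X assume "X \<in> A"
    then have "X i j \<le> clearing_map N s X i j"
      by (simp add: A_def le_fun_def)
    also have "\<dots> \<le> liab N i j"
      by (simp add: clearing_map_def allotment_le valid)
    finally show "X i j \<le> liab N i j" .
  qed
  \<comment> \<open>The zero payments are vacuously proper. They make the suprema range over a
    nonempty set and give \<open>0 \<le> U\<close>.\<close>
  have zero: "0 \<in> A"
    by (simp add: A_def clearing_map_nonneg proper_def outgoing_def)
  then have ne: "A \<noteq> {}"
    by auto
  have upper: "X \<le> U" if "X \<in> A" for X
    unfolding U_def le_fun_def using that bdd by (auto intro: cSUP_upper)
  have U0: "0 \<le> U"
    using upper[OF zero] .
  have U_le: "U \<le> clearing_map N s U"
    unfolding le_fun_def
  proof (intro allI)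
    fix i j
    have "X i j \<le> clearing_map N s U i j" if "X \<in> A" for X
    proof -
      have "X \<le> clearing_map N s X"
        using that by (simp add: A_def)
      also have "\<dots> \<le> clearing_map N s U"
        by (rule clearing_map_mono[OF upper[OF that]])
      finally show ?thesis
        by (simp add: le_fun_def)
    qed
    then show "U i j \<le> clearing_map N s U i j"
      unfolding U_def[THEN fun_cong, THEN fun_cong] by (intro cSUP_least ne)
  qed
  have "proper N U"
    unfolding proper_def
  proof (intro allI impI)
    fix i assume "0 < outgoing U i"
    then obtain j where "0 < U i j"
      using outgoing_pos_iff[OF U0] by auto
    \<comment> \<open>A positive supremum is witnessed by a single \<open>X\<close> in
      \<open>A\<close>; properness of \<open>X\<close> supplies the path, and
      \<open>X \<le> U\<close> keeps its edges.\<close>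
    then obtain X where X: "X \<in> A" "0 < X i j"
      unfolding U_def using less_cSUP_iff[OF ne bdd] by auto
    then have "0 < outgoing X i"
      using outgoing_pos_iff[of X] by (auto simp: A_def)
    then obtain v where "0 < assets N v" "(v, i) \<in> {(a, b). 0 < X a b}\<^sup>*"
      using X(1) by (auto simp: A_def proper_def)
    moreover have "{(a, b). 0 < X a b}\<^sup>* \<subseteq> {(a, b). 0 < U a b}\<^sup>*"
      using upper[OF X(1)] by (intro rtrancl_mono) (auto simp: le_fun_def intro: less_le_trans)
    ultimately show "\<exists>v. 0 < assets N v \<and> (v, i) \<in> {(a, b). 0 < U a b}\<^sup>*"
      by blast
  qed
  \<comment> \<open>Membership in \<open>A\<close> puts the image below \<open>U\<close>, the
    converse of \<open>U_le\<close>.\<close>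
  then have "clearing_map N s U \<in> A"
    using s U0 U_le clearing_map_nonneg clearing_map_mono proper_clearing_map
    by (simp add: A_def)
  then have "clearing_map N s U = U"
    using upper U_le by (simp add: antisym)
  then have "proper_clearing N s U"
    using fixed_point_clearing s U0 \<open>proper N U\<close> by (simp add: proper_clearing_def)
  moreover have "Q \<le> U" if "proper_clearing N s Q" for Q
  proof (rule upper)
    show "Q \<in> A"
      using that clearing_fixed_point[of s Q]
      by (auto simp: A_def proper_clearing_def clearing_iff le_fun_def)
  qed
  ultimately show ?thesis
    using that by blast
qed

text \<open>A greatest element exists for every profile, so \<open>GREATEST\<close> denotes it and
  bounds for arbitrary rules apply to the default one.\<close>

lemma selection_rule_max_clearing: "selection_rule N (max_clearing N)"
  unfolding selection_rule_def
proof
  fix s assume "s \<in> profiles N"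
  then obtain P where P: "proper_clearing N s P" "\<And>Q. proper_clearing N s Q \<Longrightarrow> Q \<le> P"
    by (rule greatest_proper_clearing) blast
  then have "max_clearing N s = P"
    unfolding max_clearing_def by (rule Greatest_equality)
  then show "proper_clearing N s (max_clearing N s)"
    using P(1) by simp
qed

subsection \<open>Welfare of clearing payments\<close>

text \<open>A defaulting firm has equity 0 and, as \<open>beta N = 1\<close>, pays out all it has
  except the lost amount \<open>(1 - alpha N) * assets N i\<close>.\<close>

lemma equity_clearing:
  assumes "clearing N s P"
  shows "equity N P i =
    assets N i + incoming P i - outgoing P i - (if solvent N P i then 0 else (1 - alpha N) * assets N i)"
  using assms by (auto simp: clearing_def equity_def solvent_def beta algebra_simps)

text \<open>Incoming and outgoing payments sum to the same total and cancel, leaving the assets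
  minus the default losses.\<close>

lemma social_welfare_clearing:
  assumes "clearing N s P"
  shows "social_welfare N P =
    sum (assets N) UNIV - (\<Sum>i\<in>UNIV. if solvent N P i then 0 else (1 - alpha N) * assets N i)"
proof -
  have "(\<Sum>i\<in>UNIV. incoming P i) = (\<Sum>i\<in>UNIV. outgoing P i)"
    unfolding incoming_def outgoing_def by (rule sum.swap)
  then show ?thesis
    using equity_clearing[OF assms]
    by (simp add: social_welfare_def sum.distrib sum_subtractf)
qed

lemma social_welfare_le_assets:
  assumes "clearing N s P"
  shows "social_welfare N P \<le> sum (assets N) UNIV"
proof -
  have "0 \<le> (\<Sum>i\<in>UNIV. if solvent N P i then 0 else (1 - alpha N) * assets N i)"
    using alpha assets_nonneg by (intro sum_nonneg) auto
  then show ?thesis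
    by (simp add: social_welfare_clearing[OF assms])
qed

text \<open>The losses are largest if every firm defaults.\<close>

lemma alpha_assets_le_social_welfare:
  assumes "clearing N s P"
  shows "alpha N * sum (assets N) UNIV \<le> social_welfare N P"
proof -
  have "(\<Sum>i\<in>UNIV. if solvent N P i then 0 else (1 - alpha N) * assets N i)
      \<le> (\<Sum>i\<in>UNIV. (1 - alpha N) * assets N i)"
    using alpha assets_nonneg by (intro sum_mono) auto
  also have "\<dots> = (1 - alpha N) * sum (assets N) UNIV"
    by (simp add: sum_distrib_left)
  finally show ?thesis
    by (simp add: social_welfare_clearing[OF assms] algebra_simps)
qed

end

section \<open>The optimum over all profiles and the price of anarchy\<close>

lemma finite_profiles: "finite (profiles (N :: ('v::finite) network))"
proof -
  have "profiles N \<subseteq> PiE UNIV (\<lambda>_. {c. set c \<subseteq> UNIV \<and> distinct c})"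
    by (auto simp: profiles_def is_strategy_def)
  moreover have "finite (PiE UNIV (\<lambda>_ :: 'v. {c :: 'v set list. set c \<subseteq> UNIV \<and> distinct c}))"
    by (intro finite_PiE finite_subset_distinct) auto
  ultimately show ?thesis
    by (rule finite_subset)
qed

text \<open>The profile \<open>s\<close> witnesses that the set under \<open>Max\<close> is
  nonempty.\<close>

lemma opt_welfare_le:
  fixes N :: "('v::finite) network"
  assumes "s \<in> profiles N" "\<And>t. t \<in> profiles N \<Longrightarrow> social_welfare N (R t) \<le> w"
  shows "opt_welfare N R \<le> w"
  unfolding opt_welfare_def using assms finite_profiles by (subst Max_le_iff) auto

lemma social_welfare_le_opt_welfare:
  fixes N :: "('v::finite) network"
  assumes "s \<in> profiles N"
  shows "social_welfare N (R s) \<le> opt_welfare N R"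
  unfolding opt_welfare_def using assms finite_profiles by (intro Max_ge) auto

lemma social_welfare_nonneg: "0 \<le> social_welfare N P"
  by (simp add: social_welfare_def equity_def sum_nonneg)

theorem theorem15:
  fixes N :: "('v::finite) network"
  assumes "valid_network N"
    and "0 < alpha N" and "alpha N \<le> 1" and "beta N = 1"
  shows "price_of_anarchy N (max_clearing N) \<le> ereal (1 / alpha N) \<and>
    (\<forall>R s. selection_rule N R \<longrightarrow> nash N R s \<longrightarrow>
       opt_welfare N R \<le> 1 / alpha N * social_welfare N (R s) \<and>
       opt_welfare N (max_clearing N) \<le> 1 / alpha N * social_welfare N (R s))"
proof -
  note N = assms(1) less_imp_le[OF assms(2)] assms(3,4)
  have max: "selection_rule N (max_clearing N)"
    by (rule selection_rule_max_clearing[OF N])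
  \<comment> \<open>Separate rules for the equilibrium and the optimum cover both inequalities of
    the claim: \<open>R'\<close> is taken to be \<open>R\<close> or
    \<open>max_clearing N\<close>.\<close>
  have bound: "opt_welfare N R' \<le> 1 / alpha N * social_welfare N (R s)"
    if "selection_rule N R" "selection_rule N R'" "nash N R s" for R R' s
  proof -
    have s: "s \<in> profiles N"
      using that(3) by (simp add: nash_def)
    then have "alpha N * sum (assets N) UNIV \<le> social_welfare N (R s)"
      using that(1) alpha_assets_le_social_welfare[OF N]
      by (auto simp: selection_rule_def proper_clearing_def)
    moreover have "opt_welfare N R' \<le> sum (assets N) UNIV"
      using s that(2) social_welfare_le_assets[OF N]
      by (intro opt_welfare_le) (auto simp: selection_rule_def proper_clearing_def)
    ultimately have "alpha N * opt_welfare N R' \<le> social_welfare N (R s)"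
      using assms(2) by (meson mult_left_mono less_imp_le order_trans)
    then show ?thesis
      using assms(2) by (simp add: field_simps)
  qed
  have "welfare_ratio (opt_welfare N (max_clearing N)) (social_welfare N (max_clearing N s))
      \<le> ereal (1 / alpha N)" if "nash N (max_clearing N) s" for s
  proof -
    define a where "a = opt_welfare N (max_clearing N)"
    define b where "b = social_welfare N (max_clearing N s)"
    \<comment> \<open>If \<open>b = 0\<close>, the first and last inequalities force
      \<open>a = 0\<close>, so the ratio is 1 by convention, and \<open>alpha N \<le> 1\<close>
      gives the bound.\<close>
    have "a \<le> 1 / alpha N * b" "0 \<le> b" "b \<le> a"
      using bound[OF max max that] that
      by (auto simp: a_def b_def nash_def social_welfare_nonneg social_welfare_le_opt_welfare)
    then have "welfare_ratio a b \<le> ereal (1 / alpha N)"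
      using assms(2,3) by (cases "b = 0") (auto simp: welfare_ratio_def one_ereal_def field_simps)
    then show ?thesis
      by (simp add: a_def b_def)
  qed
  then have "price_of_anarchy N (max_clearing N) \<le> ereal (1 / alpha N)"
    unfolding price_of_anarchy_def by (intro SUP_least) simp
  then show ?thesis
    using bound max by blast
qed

end
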